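(* Let $(u^n,v^n,q^n)_{n\ge 0}$, with $u^n,v^n\in\mathbb{R}^N$ and $q^n\in\mathbb{R}$, be generated by the following scheme. The initial values are $u_j^0=\phi_1(x_j)$, $v_j^0=\phi_2(x_j)$, $q^0=\sqrt{\langle G(u^0),\mathbf{1}\rangle_{l^2}+C_0}$, and for all $n\ge 0$, with $z^n=\begin{pmatrix}u^n\\ v^n\end{pmatrix}\in\mathbb{R}^{2N}$, $$z^{n+1}=\exp(V)z^n+\tau\,\phi(V)\,S\,f^{n+\frac12},\qquad f^{n+\frac12}=\begin{pmatrix}\dfrac{G'(\hat u^{n+\frac12})}{\sqrt{\langle G(\hat u^{n+\frac12}),\mathbf{1}\rangle_{l^2}+C_0}}\,q^{n+\frac12}\\ 0\end{pmatrix},$$ $$q^{n+1}=q^n+\tau\,\frac{\langle G'(\hat u^{n+\frac12}),\delta_tu^n\rangle_{l^2}}{2\sqrt{\langle G(\hat u^{n+\frac12}),\mathbf{1}\rangle_{l^2}+C_0}},$$ where $q^{n+\frac12}=\frac12(q^{n+1}+q^n)$, $\delta_tu^n=\frac1\tau(u^{n+1}-u^n)$, $\hat u^{n+\frac12}=\frac12(3u^n-u^{n-1})$ for $n\ge1$, and $\hat u^{\frac12}=u^0$ (first step). Then the discrete modified energy $$E_h^n=\frac12\|v^n\|_{l^2}^2+\frac{\omega^2}{2}\|\delta_x^+u^n\|_{l^2}^2+(q^n)^2-C_0$$ satisfies $E_h^{n+1}=E_h^n$ for all $n=0,1,2,\dots$.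
   Context: Setting: $\omega\in\mathbb{R}$; $G:\mathbb{R}\to\mathbb{R}$ is smooth with $G\ge 0$, and $G,G'$ act componentwise on vectors; $\phi_1,\phi_2$ are given real-valued functions (initial data); $\tau>0$ is the time step. The interval $(a,b)$ is discretized with an even positive integer $N$, $h=(b-a)/N$, grid points $x_j=a+jh$. Vectors $w=(w_0,\dots,w_{N-1})^T$ are extended periodically ($w_N=w_0$, $w_{-1}=w_{N-1}$). $\delta_x^+w_j=\frac{w_{j+1}-w_j}{h}$, $\delta_x^2w_j=\frac{w_{j+1}-2w_j+w_{j-1}}{h^2}$. For real vectors, $\langle u,v\rangle_{l^2}=h\sum_{j=0}^{N-1}u_jv_j$, $\|v\|_{l^2}^2=h\sum_{j=0}^{N-1}|v_j|^2$, $\|\delta_x^+u\|_{l^2}^2=h\sum_{j=0}^{N-1}|\delta_x^+u_j|^2$; $\mathbf{1}=(1,\dots,1)^T$. $C_0$ is a real constant large enough that all the quantities $\langle G(\cdot),\mathbf 1\rangle_{l^2}+C_0$ appearing under square roots are positive. $B_2$ is the $N\times N$ matrix of $\delta_x^2$ with periodic boundary condition. With $N\times N$ blocks, $$S=\begin{pmatrix}O&I\\-I&O\end{pmatrix},\quad M=\begin{pmatrix}-\omega^2B_2&O\\O&I\end{pmatrix},\quad V=\tau SM,\quad \phi(V)=\int_0^1\exp((1-\xi)V)\,d\xi,$$ where $\exp$ is the matrix exponential. The scheme approximates the nonlinear Klein–Gordon equation $u_{tt}-\omega^2u_{xx}+G'(u)=0$ with $u(x,0)=\phi_1$, $u_t(x,0)=\phi_2$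 and periodic boundary conditions; $u_j^n$ and $v_j^n$ approximate $u(x_j,t_n)$ and $u_t(x_j,t_n)$, $t_n=n\tau$. *)

theory Defs
  imports "HOL-Analysis.Analysis" "Jordan_Normal_Form.Matrix"
begin

unbundle no vec_syntax
unbundle no inner_syntax

definition smooth :: "(real \<Rightarrow> real) \<Rightarrow> bool" where
  "smooth G \<longleftrightarrow> (\<forall>k x. (deriv ^^ k) G field_differentiable (at x))"

definition periodic_ext :: "real Matrix.vec \<Rightarrow> int \<Rightarrow> real" where
  "periodic_ext w j = w $ nat (j mod int (dim_vec w))"

definition dx_plus :: "real \<Rightarrow> real Matrix.vec \<Rightarrow> real Matrix.vec" where
  "dx_plus h w = Matrix.vec (dim_vec w)
     (\<lambda>j. (periodic_ext w (int j + 1) - periodic_ext w (int j)) / h)"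

definition dx_sq :: "real \<Rightarrow> real Matrix.vec \<Rightarrow> real Matrix.vec" where
  "dx_sq h w = Matrix.vec (dim_vec w)
     (\<lambda>j. (periodic_ext w (int j + 1) - 2 * periodic_ext w (int j) + periodic_ext w (int j - 1))
            / h\<^sup>2)"

definition l2_inner :: "real \<Rightarrow> real Matrix.vec \<Rightarrow> real Matrix.vec \<Rightarrow> real" where
  "l2_inner h u v = h * (\<Sum>j<dim_vec u. u $ j * v $ j)"

definition l2_norm :: "real \<Rightarrow> real Matrix.vec \<Rightarrow> real" where
  "l2_norm h v = sqrt (h * (\<Sum>j<dim_vec v. \<bar>v $ j\<bar>\<^sup>2))"

definition ones_vec :: "nat \<Rightarrow> real Matrix.vec" where
  "ones_vec N = Matrix.vec N (\<lambda>_. 1)"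

text \<open>The type of matrices with explicit dimensions carries no topology, so the exponential
  series and the matrix-valued integral below are taken entry by entry.\<close>

definition mat_exp :: "real Matrix.mat \<Rightarrow> real Matrix.mat" where
  "mat_exp A = Matrix.mat (dim_row A) (dim_row A)
     (\<lambda>(i, j). \<Sum>k. (A ^\<^sub>m k) $$ (i, j) / fact k)"

definition mat_phi :: "real Matrix.mat \<Rightarrow> real Matrix.mat" where
  "mat_phi A = Matrix.mat (dim_row A) (dim_row A)
     (\<lambda>(i, j). integral {0..1} (\<lambda>\<xi>. mat_exp ((1 - \<xi>) \<cdot>\<^sub>m A) $$ (i, j)))"

text \<open>The matrix of \<^term>\<open>dx_sq h\<close> in the standard basis: column \<open>j\<close> is the image of the
  \<open>j\<close>-th unit vector.  For \<open>N = 2\<close> the two neighbours of a grid point coincide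
  and their contributions add up.\<close>

definition B2_mat :: "nat \<Rightarrow> real \<Rightarrow> real Matrix.mat" where
  "B2_mat N h = Matrix.mat N N (\<lambda>(i, j). dx_sq h (unit_vec N j) $ i)"

definition S_mat :: "nat \<Rightarrow> real Matrix.mat" where
  "S_mat N = four_block_mat (0\<^sub>m N N) (1\<^sub>m N) (- 1\<^sub>m N) (0\<^sub>m N N)"

definition M_mat :: "nat \<Rightarrow> real \<Rightarrow> real \<Rightarrow> real Matrix.mat" where
  "M_mat N h \<omega> = four_block_mat ((- (\<omega>\<^sup>2)) \<cdot>\<^sub>m B2_mat N h) (0\<^sub>m N N) (0\<^sub>m N N) (1\<^sub>m N)"

definition V_mat :: "nat \<Rightarrow> real \<Rightarrow> real \<Rightarrow> real \<Rightarrow> real Matrix.mat" where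
  "V_mat N h \<omega> \<tau> = \<tau> \<cdot>\<^sub>m (S_mat N * M_mat N h \<omega>)"

text \<open>\<open>u_hat u n\<close> is the extrapolated value at time level \<open>n + 1/2\<close>.\<close>

definition u_hat :: "(nat \<Rightarrow> real Matrix.vec) \<Rightarrow> nat \<Rightarrow> real Matrix.vec" where
  "u_hat u n = (if n = 0 then u 0 else (1/2) \<cdot>\<^sub>v (3 \<cdot>\<^sub>v u n - u (n - 1)))"

text \<open>The radicand \<open>\<langle>G(w), 1\<rangle> + C\<^sub>0\<close>.\<close>

definition G_energy :: "real \<Rightarrow> real \<Rightarrow> (real \<Rightarrow> real) \<Rightarrow> real Matrix.vec \<Rightarrow> real" where
  "G_energy h C0 G w = l2_inner h (map_vec G w) (ones_vec (dim_vec w)) + C0"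

definition f_half ::
  "real \<Rightarrow> real \<Rightarrow> (real \<Rightarrow> real) \<Rightarrow> real Matrix.vec \<Rightarrow> real \<Rightarrow> real Matrix.vec" where
  "f_half h C0 G uh qh =
     ((1 / sqrt (G_energy h C0 G uh) * qh) \<cdot>\<^sub>v map_vec (deriv G) uh) @\<^sub>v 0\<^sub>v (dim_vec uh)"

definition modified_energy ::
  "real \<Rightarrow> real \<Rightarrow> real \<Rightarrow> real Matrix.vec \<Rightarrow> real Matrix.vec \<Rightarrow> real \<Rightarrow> real" where
  "modified_energy h \<omega> C0 u v q =
     1/2 * (l2_norm h v)\<^sup>2 + \<omega>\<^sup>2 / 2 * (l2_norm h (dx_plus h u))\<^sup>2 + q\<^sup>2 - C0"

end

theory Submission
  imports Defs
begin

text \<open>One step of the scheme is the value at time \<open>1\<close> of the solution of the linear system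
  \<open>z' = \<tau> S (M z + f)\<close> with \<open>f\<close> frozen at \<open>f\<^bsup>n+1/2\<^esup>\<close>. Since \<open>S\<close> is skew and \<open>M\<close> symmetric, the
  Hamiltonian \<open>z\<^sup>T M z / 2 + f\<^sup>T z\<close> is constant along that solution; arguing with the flow avoids
  inverting the singular matrix \<open>M\<close>. The change of \<open>f\<^sup>T z\<close> over the step, scaled by \<open>h\<close>, equals
  that of \<open>q\<^sup>2\<close> by the update rule of \<open>q\<close>, and summation by parts turns \<open>h z\<^sup>T M z / 2\<close> into the
  kinetic and gradient parts of the energy.\<close>

section \<open>Powers and exponentials of square matrices, entry by entry\<close>

lemma pow_mat_Suc_left:
  fixes A :: "'a :: semiring_1 mat"
  assumes "A \<in> carrier_mat n n"
  shows "A ^\<^sub>m Suc k = A * A ^\<^sub>m k"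
proof (induction k)
  case 0
  show ?case using assms by simp
next
  case (Suc k)
  have "A ^\<^sub>m Suc (Suc k) = (A * A ^\<^sub>m k) * A" using Suc by simp
  also have "\<dots> = A * (A ^\<^sub>m k * A)"
    using assms by (intro assoc_mult_mat[of _ n n _ n _ n] pow_carrier_mat) auto
  finally show ?case by simp
qed

lemma smult_pow_mat:
  fixes A :: "'a :: comm_semiring_1 mat"
  assumes "A \<in> carrier_mat n n"
  shows "(s \<cdot>\<^sub>m A) ^\<^sub>m k = s ^ k \<cdot>\<^sub>m A ^\<^sub>m k"
proof (induction k)
  case 0
  show ?case using assms by (intro eq_matI) auto
next
  case (Suc k)
  have P: "A ^\<^sub>m k \<in> carrier_mat n n" using assms by simp
  have "(s \<cdot>\<^sub>m A) ^\<^sub>m Suc k = (s ^ k \<cdot>\<^sub>m A ^\<^sub>m k) * (s \<cdot>\<^sub>m A)" using Suc by simp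
  also have "\<dots> = s ^ Suc k \<cdot>\<^sub>m (A ^\<^sub>m k * A)"
    using P assms by (intro eq_matI) (auto simp: scalar_prod_def sum_distrib_left mult_ac)
  finally show ?case by simp
qed

text \<open>The recursion of matrix powers adds the new factor on the right. Peeling it off on the
  left instead gives the derivative of the exponential in the form \<open>A\<close> times
  exponential, as the flow equation requires.\<close>

lemma index_pow_mat_Suc_left:
  fixes A :: "'a :: semiring_1 mat"
  assumes "A \<in> carrier_mat n n" "i < n" "j < n"
  shows "(A ^\<^sub>m Suc k) $$ (i, j) = (\<Sum>l<n. A $$ (i, l) * (A ^\<^sub>m k) $$ (l, j))"
proof -
  have "A ^\<^sub>m k \<in> carrier_mat n n" using assms by simp
  then show ?thesis
    unfolding pow_mat_Suc_left[OF assms(1)] using assms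
    by (simp add: scalar_prod_def lessThan_atLeast0)
qed

text \<open>Each further factor replaces an entry by a sum of \<open>n\<close> products, which costs
  at most \<open>n * C\<close>. The row varies in the induction because the left factor mixes the
  rows of the smaller power.\<close>

lemma pow_mat_entry_bound:
  fixes A :: "real mat"
  assumes A: "A \<in> carrier_mat n n" and C: "\<And>i j. i < n \<Longrightarrow> j < n \<Longrightarrow> \<bar>A $$ (i, j)\<bar> \<le> C"
    and "i < n" "j < n"
  shows "\<bar>(A ^\<^sub>m k) $$ (i, j)\<bar> \<le> (real n * C) ^ k"
  using \<open>i < n\<close>
proof (induction k arbitrary: i)
  case 0
  then show ?case using A \<open>j < n\<close> by simp
next
  case (Suc k)
  have C0: "0 \<le> C" using C[OF \<open>i < n\<close> \<open>j < n\<close>] by linarith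
  have "\<bar>(A ^\<^sub>m Suc k) $$ (i, j)\<bar> \<le> (\<Sum>l<n. \<bar>A $$ (i, l)\<bar> * \<bar>(A ^\<^sub>m k) $$ (l, j)\<bar>)"
    unfolding index_pow_mat_Suc_left[OF A Suc.prems \<open>j < n\<close>] abs_mult[symmetric]
    by (rule sum_abs)
  also have "\<dots> \<le> (\<Sum>l<n. C * (real n * C) ^ k)"
    using Suc C C0 by (intro sum_mono mult_mono) auto
  finally show ?case by simp
qed

lemma summable_mat_exp_entry:
  fixes A :: "real mat"
  assumes A: "A \<in> carrier_mat n n" and ij: "i < n" "j < n"
  shows "summable (\<lambda>k. (A ^\<^sub>m k) $$ (i, j) / fact k * s ^ k)"
proof -
  \<comment> \<open>The largest modulus of an entry; the series is then dominated by the exponential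
    series at \<open>n * C * \<bar>s\<bar>\<close>.\<close>
  define C where "C = Max ((\<lambda>(i, j). \<bar>A $$ (i, j)\<bar>) ` ({..<n} \<times> {..<n}))"
  have C: "\<bar>A $$ (i, j)\<bar> \<le> C" if "i < n" "j < n" for i j
    unfolding C_def using that by (intro Max_ge) auto
  show ?thesis
  proof (rule summable_comparison_test')
    show "summable (\<lambda>k. inverse (fact k) * (real n * C * \<bar>s\<bar>) ^ k)"
      by (rule summable_exp)
    show "norm ((A ^\<^sub>m k) $$ (i, j) / fact k * s ^ k) \<le> inverse (fact k) * (real n * C * \<bar>s\<bar>) ^ k" for k
      using mult_right_mono[OF pow_mat_entry_bound[OF A C ij], of "inverse (fact k) * \<bar>s\<bar> ^ k" k]
      by (simp add: abs_mult power_abs power_mult_distrib field_simps)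
  qed
qed

text \<open>Moving the scalar out of the powers makes each entry a power series in \<open>s\<close>,
  so that real termwise differentiation applies.\<close>

lemma mat_exp_smult_entry:
  assumes "A \<in> carrier_mat n n" "i < n" "j < n"
  shows "mat_exp (s \<cdot>\<^sub>m A) $$ (i, j) = (\<Sum>k. (A ^\<^sub>m k) $$ (i, j) / fact k * s ^ k)"
proof -
  have "A ^\<^sub>m k \<in> carrier_mat n n" for k using assms by simp
  then show ?thesis
    unfolding mat_exp_def using assms
    by (auto simp: smult_pow_mat[OF assms(1)] mult_ac intro!: suminf_cong)
qed

lemma mat_exp_entry_has_derivative:
  assumes A: "A \<in> carrier_mat n n" and ij: "i < n" "j < n"
  shows "((\<lambda>s. mat_exp (s \<cdot>\<^sub>m A) $$ (i, j)) has_real_derivative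
    (\<Sum>l<n. A $$ (i, l) * mat_exp (s \<cdot>\<^sub>m A) $$ (l, j))) (at s)"
proof -
  define c where "c i k = (A ^\<^sub>m k) $$ (i, j) / fact k" for i k
  have S: "summable (\<lambda>k. c i k * s ^ k)" if "i < n" for i s
    unfolding c_def by (rule summable_mat_exp_entry[OF A that ij(2)])
  \<comment> \<open>Differentiation shifts the coefficients: the factor \<open>Suc k\<close> cancels
    against the factorial, and the extra power of \<open>A\<close> comes off on the left.\<close>
  have "diffs (c i) k = (\<Sum>l<n. A $$ (i, l) * c l k)" for k
  proof -
    have "real (Suc k) * (x / fact (Suc k)) = x / fact k" for x :: real
      by (simp del: of_nat_Suc)
    then show ?thesis
      unfolding diffs_def c_def index_pow_mat_Suc_left[OF A ij]
      by (simp only:) (simp add: sum_divide_distrib)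
  qed
  then have "(\<Sum>k. diffs (c i) k * s ^ k) = (\<Sum>k. \<Sum>l<n. A $$ (i, l) * (c l k * s ^ k))"
    by (simp add: sum_distrib_left sum_distrib_right mult_ac)
  also have "\<dots> = (\<Sum>l<n. \<Sum>k. A $$ (i, l) * (c l k * s ^ k))"
    using S by (intro suminf_sum summable_mult) auto
  also have "\<dots> = (\<Sum>l<n. A $$ (i, l) * (\<Sum>k. c l k * s ^ k))"
    using S by (intro sum.cong suminf_mult) auto
  finally have "(\<Sum>k. diffs (c i) k * s ^ k) = (\<Sum>l<n. A $$ (i, l) * (\<Sum>k. c l k * s ^ k))" .
  moreover have "((\<lambda>s. \<Sum>k. c i k * s ^ k) has_real_derivative (\<Sum>k. diffs (c i) k * s ^ k)) (at s)"
    by (rule termdiffs_strong_converges_everywhere) (rule S[OF ij(1)])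
  ultimately show ?thesis
    using mat_exp_smult_entry[OF A _ ij(2)] ij by (simp add: c_def)
qed

lemma mat_exp_zero_entry:
  assumes "A \<in> carrier_mat n n" "i < n" "j < n"
  shows "mat_exp (0 \<cdot>\<^sub>m A) $$ (i, j) = (if i = j then 1 else 0)"
  using powser_zero[of "\<lambda>k. (A ^\<^sub>m k) $$ (i, j) / fact k"] assms
  by (simp add: mat_exp_smult_entry[OF assms])

section \<open>The phi-function as a time integral of the exponential\<close>

definition mat_exp_integral :: "real mat \<Rightarrow> real \<Rightarrow> nat \<Rightarrow> nat \<Rightarrow> real" where
  "mat_exp_integral A s i j = integral {0..s} (\<lambda>\<xi>. mat_exp (\<xi> \<cdot>\<^sub>m A) $$ (i, j))"

text \<open>The derivative at 0 has to be one-sided: for negative \<open>s\<close> the interval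
  \<open>{0..s}\<close> is empty and the integral is 0, whereas diagonal entries of the exponential
  equal 1 at time 0.\<close>

lemma mat_exp_integral_has_derivative:
  assumes A: "A \<in> carrier_mat n n" and ij: "i < n" "j < n" and s: "s \<in> {0..1}"
  shows "((\<lambda>s. mat_exp_integral A s i j) has_real_derivative mat_exp (s \<cdot>\<^sub>m A) $$ (i, j))
    (at s within {0..1})"
  unfolding mat_exp_integral_def
  using mat_exp_entry_has_derivative[OF A ij] s
  by (intro integral_has_real_derivative continuous_at_imp_continuous_on) (auto intro: DERIV_isCont)

text \<open>This is the substitution of \<open>1 - x\<close> for \<open>x\<close>, carried out by
  exhibiting an antiderivative of the reversed integrand.\<close>

lemma mat_phi_entry:
  assumes A: "A \<in> carrier_mat n n" and ij: "i < n" "j < n"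
  shows "mat_phi A $$ (i, j) = mat_exp_integral A 1 i j"
proof -
  have "((\<lambda>x. - mat_exp_integral A (1 - x) i j) has_real_derivative mat_exp ((1 - x) \<cdot>\<^sub>m A) $$ (i, j))
      (at x within {0..1})" if x: "x \<in> {0..1}" for x
  proof -
    have *: "((\<lambda>s. mat_exp_integral A s i j) has_real_derivative mat_exp ((1 - x) \<cdot>\<^sub>m A) $$ (i, j))
      (at (1 - x) within (\<lambda>x. 1 - x) ` {0..1})"
      using mat_exp_integral_has_derivative[OF A ij, of "1 - x"] x
      by (auto intro: DERIV_subset)
    have "((\<lambda>x::real. 1 - x) has_real_derivative -1) (at x within {0..1})"
      by (auto intro!: derivative_eq_intros)
    from DERIV_minus[OF DERIV_image_chain[OF * this]] show ?thesis by (simp add: o_def)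
  qed
  then have "((\<lambda>x. mat_exp ((1 - x) \<cdot>\<^sub>m A) $$ (i, j)) has_integral
      - mat_exp_integral A (1 - 1) i j - - mat_exp_integral A (1 - 0) i j) {0..1}"
    by (intro fundamental_theorem_of_calculus)
      (auto simp: has_real_derivative_iff_has_vector_derivative[symmetric])
  then have "integral {0..1} (\<lambda>x. mat_exp ((1 - x) \<cdot>\<^sub>m A) $$ (i, j)) = mat_exp_integral A 1 i j"
    by (simp add: integral_unique mat_exp_integral_def)
  then show ?thesis
    using A ij by (simp add: mat_phi_def)
qed

text \<open>Both sides have the same derivative on the unit interval and agree at 0. The identity
  stands in for writing the integral as the inverse of \<open>A\<close> times (exponential minus
  identity), which would need \<open>A\<close> invertible.\<close>

lemma mat_exp_eq_mat_exp_integral: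
  assumes A: "A \<in> carrier_mat n n" and ij: "i < n" "j < n" and s: "s \<in> {0..1}"
  shows "mat_exp (s \<cdot>\<^sub>m A) $$ (i, j)
    = (if i = j then 1 else 0) + (\<Sum>l<n. A $$ (i, l) * mat_exp_integral A s l j)"
proof -
  define D where "D s = mat_exp (s \<cdot>\<^sub>m A) $$ (i, j) - (\<Sum>l<n. A $$ (i, l) * mat_exp_integral A s l j)" for s
  have "(D has_real_derivative 0) (at s within {0..1})" if s: "s \<in> {0..1}" for s
    unfolding D_def
    by (auto intro!: derivative_eq_intros DERIV_sum
        has_field_derivative_at_within[OF mat_exp_entry_has_derivative[OF A ij]]
        mat_exp_integral_has_derivative[OF A _ ij(2) s] simp: mult.commute)
  then obtain c where "\<And>s. s \<in> {0..1} \<Longrightarrow> D s = c"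
    using has_field_derivative_zero_constant[of "{0..1::real}" D] by auto
  then have "D s = D 0" using s by simp
  then show ?thesis
    unfolding D_def mat_exp_zero_entry[OF A ij] by (simp add: mat_exp_integral_def)
qed

section \<open>Conservation of the Hamiltonian over one exponential step with frozen force\<close>

lemma exponential_integrator_energy:
  fixes M S :: "real mat" and f z z' :: "real vec"
  assumes M: "M \<in> carrier_mat n n" and S: "S \<in> carrier_mat n n"
    and f: "f \<in> carrier_vec n" and z: "z \<in> carrier_vec n"
    and sym: "\<And>i j. i < n \<Longrightarrow> j < n \<Longrightarrow> M $$ (i, j) = M $$ (j, i)"
    and skew: "\<And>i j. i < n \<Longrightarrow> j < n \<Longrightarrow> S $$ (i, j) = - S $$ (j, i)"
    and z': "z' = mat_exp (\<tau> \<cdot>\<^sub>m (S * M)) *\<^sub>v z + \<tau> \<cdot>\<^sub>v ((mat_phi (\<tau> \<cdot>\<^sub>m (S * M)) * S) *\<^sub>v f)"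
  shows "1/2 * (z' \<bullet> (M *\<^sub>v z')) + f \<bullet> z' = 1/2 * (z \<bullet> (M *\<^sub>v z)) + f \<bullet> z"
proof -
  define A where "A = \<tau> \<cdot>\<^sub>m (S * M)"
  have A: "A \<in> carrier_mat n n" using M S by (simp add: A_def)
  \<comment> \<open>Variation of constants: \<open>g\<close> is the constant inhomogeneity tau S f,
    and \<open>y\<close> is the solution of y' = A y + g starting at \<open>z\<close>. The vector
    \<open>w\<close> = M y + f is the gradient of the Hamiltonian \<open>H\<close> at
    \<open>y\<close>.\<close>
  define g where "g i = \<tau> * (\<Sum>k<n. S $$ (i, k) * f $ k)" for i
  define y where "y s i = (\<Sum>j<n. mat_exp (s \<cdot>\<^sub>m A) $$ (i, j) * z $ j)
    + (\<Sum>j<n. mat_exp_integral A s i j * g j)" for s i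
  define w where "w s i = (\<Sum>j<n. M $$ (i, j) * y s j) + f $ i" for s i
  define H where "H s = 1/2 * (\<Sum>i<n. y s i * (\<Sum>j<n. M $$ (i, j) * y s j)) + (\<Sum>i<n. f $ i * y s i)" for s
  have dy: "((\<lambda>s. y s i) has_real_derivative \<tau> * (\<Sum>k<n. S $$ (i, k) * w s k)) (at s within {0..1})"
    if i: "i < n" and s: "s \<in> {0..1}" for i s
  proof -
    \<comment> \<open>In the second sum the exponential is rewritten as identity plus
      \<open>A\<close> times its integral: the identity contributes \<open>g\<close>, and the rest
      completes \<open>A\<close> applied to \<open>y\<close>.\<close>
    have "(\<Sum>j<n. (\<Sum>l<n. A $$ (i, l) * mat_exp (s \<cdot>\<^sub>m A) $$ (l, j)) * z $ j)
        + (\<Sum>j<n. mat_exp (s \<cdot>\<^sub>m A) $$ (i, j) * g j)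
      = (\<Sum>j<n. \<Sum>l<n. A $$ (i, l) * mat_exp (s \<cdot>\<^sub>m A) $$ (l, j) * z $ j)
        + ((\<Sum>j<n. \<Sum>l<n. A $$ (i, l) * mat_exp_integral A s l j * g j) + g i)"
      using i by (simp add: mat_exp_eq_mat_exp_integral[OF A i _ s] distrib_right
          sum.distrib sum_distrib_right if_distrib[of "\<lambda>x. x * _"] cong: if_cong)
    also have "\<dots> = (\<Sum>l<n. A $$ (i, l) * y s l) + g i"
      unfolding y_def
      by (subst (1 2) sum.swap) (simp add: distrib_left sum.distrib sum_distrib_left mult_ac)
    also have "(\<Sum>l<n. A $$ (i, l) * y s l) = \<tau> * (\<Sum>l<n. \<Sum>k<n. S $$ (i, k) * (M $$ (k, l) * y s l))"
      using M S i by (simp add: A_def scalar_prod_def lessThan_atLeast0 sum_distrib_left sum_distrib_right mult_ac)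
    also have "\<dots> + g i = \<tau> * (\<Sum>k<n. S $$ (i, k) * w s k)"
      unfolding w_def g_def
      by (subst sum.swap) (simp add: distrib_left sum.distrib sum_distrib_left)
    finally have *: "(\<Sum>j<n. (\<Sum>l<n. A $$ (i, l) * mat_exp (s \<cdot>\<^sub>m A) $$ (l, j)) * z $ j)
        + (\<Sum>j<n. mat_exp (s \<cdot>\<^sub>m A) $$ (i, j) * g j) = \<tau> * (\<Sum>k<n. S $$ (i, k) * w s k)" .
    show ?thesis
      unfolding y_def *[symmetric]
      by (intro DERIV_add DERIV_sum DERIV_cmult_right
          has_field_derivative_at_within[OF mat_exp_entry_has_derivative[OF A i]]
          mat_exp_integral_has_derivative[OF A i _ s]) auto
  qed
  have "(H has_real_derivative 0) (at s within {0..1})" if s: "s \<in> {0..1}" for s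
  proof -
    define d where "d i = \<tau> * (\<Sum>k<n. S $$ (i, k) * w s k)" for i
    have dy': "((\<lambda>s. y s i) has_real_derivative d i) (at s within {0..1})" if "i < n" for i
      unfolding d_def by (rule dy[OF that s])
    \<comment> \<open>By symmetry of \<open>M\<close> the two halves of the product rule coincide,
      which absorbs the factor 1/2.\<close>
    have "(\<Sum>i<n. y s i * (\<Sum>j<n. M $$ (i, j) * d j)) = (\<Sum>i<n. \<Sum>j<n. M $$ (j, i) * y s i * d j)"
      using sym by (auto simp: sum_distrib_left mult_ac intro!: sum.cong)
    also have "\<dots> = (\<Sum>i<n. d i * (\<Sum>j<n. M $$ (i, j) * y s j))"
      by (subst sum.swap) (simp add: sum_distrib_left mult_ac)
    finally have 1: "(\<Sum>i<n. y s i * (\<Sum>j<n. M $$ (i, j) * d j)) = (\<Sum>i<n. d i * (\<Sum>j<n. M $$ (i, j) * y s j))" .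
    \<comment> \<open>Exchanging the two indices shows that the quadratic form of the skew matrix
      \<open>S\<close> at \<open>w\<close> equals its own negative.\<close>
    have "(\<Sum>i<n. \<Sum>k<n. w s i * S $$ (i, k) * w s k) = (\<Sum>k<n. \<Sum>i<n. w s i * S $$ (i, k) * w s k)"
      by (rule sum.swap)
    also have "\<dots> = (\<Sum>k<n. \<Sum>i<n. - (w s k * S $$ (k, i) * w s i))"
    proof (intro sum.cong refl)
      fix i k assume "k \<in> {..<n}" "i \<in> {..<n}"
      then show "w s i * S $$ (i, k) * w s k = - (w s k * S $$ (k, i) * w s i)"
        using skew[of i k] by (simp only: lessThan_iff) simp
    qed
    finally have 2: "(\<Sum>i<n. \<Sum>k<n. w s i * S $$ (i, k) * w s k) = 0"
      by (simp add: sum_negf)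
    have "1/2 * (\<Sum>i<n. d i * (\<Sum>j<n. M $$ (i, j) * y s j) + (\<Sum>j<n. M $$ (i, j) * d j) * y s i)
        + (\<Sum>i<n. f $ i * d i) = (\<Sum>i<n. d i * (\<Sum>j<n. M $$ (i, j) * y s j)) + (\<Sum>i<n. f $ i * d i)"
      using 1 by (simp add: sum.distrib mult_ac)
    also have "\<dots> = (\<Sum>i<n. w s i * d i)"
      by (simp add: w_def distrib_left sum.distrib mult_ac)
    also have "\<dots> = \<tau> * (\<Sum>i<n. \<Sum>k<n. w s i * S $$ (i, k) * w s k)"
      unfolding d_def by (simp add: sum_distrib_left mult_ac)
    finally have 3: "1/2 * (\<Sum>i<n. d i * (\<Sum>j<n. M $$ (i, j) * y s j) + (\<Sum>j<n. M $$ (i, j) * d j) * y s i)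
        + (\<Sum>i<n. f $ i * d i) = 0" using 2 by simp
    have "(H has_real_derivative 1/2 * (\<Sum>i<n. d i * (\<Sum>j<n. M $$ (i, j) * y s j)
        + (\<Sum>j<n. M $$ (i, j) * d j) * y s i) + (\<Sum>i<n. f $ i * d i)) (at s within {0..1})"
      unfolding H_def
      by (intro DERIV_add DERIV_sum DERIV_cmult DERIV_mult dy') auto
    then show ?thesis unfolding 3 .
  qed
  then obtain c where c: "\<And>s. s \<in> {0..1} \<Longrightarrow> H s = c"
    using has_field_derivative_zero_constant[of "{0..1::real}" H] by auto
  have H10: "H 1 = H 0" using c[of 1] c[of 0] by simp
  have y0: "y 0 i = z $ i" if "i < n" for i
    using that by (simp add: y_def mat_exp_zero_entry[OF A that] mat_exp_integral_def
        if_distrib[of "\<lambda>x. x * _"] cong: if_cong)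
  have E: "mat_exp A \<in> carrier_mat n n" and P: "mat_phi A \<in> carrier_mat n n"
    using A unfolding mat_exp_def mat_phi_def by (simp_all only: carrier_matD mat_carrier)
  have z'c: "z' \<in> carrier_vec n"
    unfolding z' A_def[symmetric] using P S f
    by (intro add_carrier_vec mult_mat_vec_carrier[OF E z] smult_carrier_vec[THEN iffD2]
        mult_mat_vec_carrier[of _ n n] mult_carrier_mat[of _ n n])
  \<comment> \<open>At time 1 the integral of the exponential is the phi-function, so the flow lands
    on the update of the scheme.\<close>
  have y1: "y 1 i = z' $ i" if i: "i < n" for i
  proof -
    have one: "1 \<cdot>\<^sub>m A = A" by (intro eq_matI) auto
    have "(mat_phi A * S) *\<^sub>v f = mat_phi A *\<^sub>v (S *\<^sub>v f)"
      using P S f by simp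
    moreover have "\<tau> * (mat_phi A *\<^sub>v (S *\<^sub>v f)) $ i = (\<Sum>j<n. mat_exp_integral A 1 i j * g j)"
      using P S f i mat_phi_entry[OF A i]
      by (simp add: scalar_prod_def lessThan_atLeast0 g_def sum_distrib_left mult_ac)
    ultimately show ?thesis
      unfolding z' A_def[symmetric] using E P S f z i
      by (simp add: y_def one scalar_prod_def lessThan_atLeast0)
  qed
  have energy: "1/2 * (x \<bullet> (M *\<^sub>v x)) + f \<bullet> x = H s"
    if "x \<in> carrier_vec n" "\<And>i. i < n \<Longrightarrow> y s i = x $ i" for x s
    using that M f by (simp add: H_def scalar_prod_def lessThan_atLeast0)
  show ?thesis
    using energy[OF z'c y1] energy[OF z y0] H10 by simp
qed

section \<open>Periodic differences and the matrix of the second difference\<close>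

lemma periodic_ext_int: "j < dim_vec w \<Longrightarrow> periodic_ext w (int j) = w $ j"
  by (simp add: periodic_ext_def)

lemma periodic_ext_add_period: "periodic_ext w (j + int (dim_vec w)) = periodic_ext w j"
  by (simp add: periodic_ext_def)

text \<open>Evaluation at a fixed index picks out one entry, hence is linear in the vector. This
  transfers the column-wise definition of \<open>B2_mat\<close> to arbitrary vectors, including the
  case where both neighbours coincide.\<close>

lemma periodic_ext_unit_vec_expansion:
  assumes "u \<in> carrier_vec N" "0 < N"
  shows "periodic_ext u k = (\<Sum>j<N. periodic_ext (unit_vec N j) k * u $ j)"
proof -
  have "nat (k mod int N) < N" using assms by (simp add: nat_less_iff)
  then show ?thesis
    using assms by (simp add: periodic_ext_def if_distrib[of "\<lambda>x. x * _"] cong: if_cong)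
qed

lemma dim_dx [simp]: "dim_vec (dx_plus h u) = dim_vec u" "dim_vec (dx_sq h u) = dim_vec u"
  by (simp_all add: dx_plus_def dx_sq_def)

lemma B2_mat_mult_vec:
  assumes u: "u \<in> carrier_vec N"
  shows "B2_mat N h *\<^sub>v u = dx_sq h u"
proof (rule eq_vecI)
  fix i assume "i < dim_vec (dx_sq h u)"
  then have i: "i < N" and N: "0 < N" using u by auto
  let ?e = "\<lambda>j. periodic_ext (unit_vec N j)"
  have "(B2_mat N h *\<^sub>v u) $ i
      = (\<Sum>j<N. (?e j (int i + 1) - 2 * ?e j (int i) + ?e j (int i - 1)) / h\<^sup>2 * u $ j)"
    using u i by (simp add: B2_mat_def dx_sq_def scalar_prod_def lessThan_atLeast0)
  also have "\<dots> = (\<Sum>j<N. (?e j (int i + 1) * u $ j - 2 * (?e j (int i) * u $ j)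
      + ?e j (int i - 1) * u $ j) / h\<^sup>2)"
    by (simp add: left_diff_distrib distrib_right mult.assoc)
  also have "\<dots> = (periodic_ext u (int i + 1) - 2 * periodic_ext u (int i) + periodic_ext u (int i - 1)) / h\<^sup>2"
    by (simp only: periodic_ext_unit_vec_expansion[OF u N] sum_divide_distrib[symmetric]
        sum.distrib sum_subtractf sum_distrib_left)
  also have "\<dots> = dx_sq h u $ i"
    using u i by (simp add: dx_sq_def)
  finally show "(B2_mat N h *\<^sub>v u) $ i = dx_sq h u $ i" .
qed (use u in \<open>simp add: B2_mat_def\<close>)

text \<open>The sum of both sides' integrands telescopes, and periodicity kills the boundary terms.
  The bilinear form serves twice: for the symmetry of \<open>B2_mat\<close> and, with
  \<open>w\<close> equal to \<open>u\<close>, for the gradient energy.\<close>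

lemma dx_sq_summation_by_parts:
  assumes u: "u \<in> carrier_vec N" and w: "w \<in> carrier_vec N"
  shows "w \<bullet> dx_sq h u = - (dx_plus h w \<bullet> dx_plus h u)"
proof -
  \<comment> \<open>The discrete flux: \<open>w\<close> times the backward difference of
    \<open>u\<close>, divided by the step size once more.\<close>
  define g where "g j = periodic_ext w (int j) * (periodic_ext u (int j) - periodic_ext u (int j - 1)) / h\<^sup>2" for j
  have *: "W * ((A - 2 * B + C) / h\<^sup>2) + (W' - W) / h * ((A - B) / h)
      = W' * (A - B) / h\<^sup>2 - W * (B - C) / h\<^sup>2" for W W' A B C :: real
    by (simp add: power2_eq_square divide_inverse algebra_simps)
  have "w \<bullet> dx_sq h u + dx_plus h w \<bullet> dx_plus h u = (\<Sum>j<N.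
      periodic_ext w (int j) * ((periodic_ext u (int j + 1) - 2 * periodic_ext u (int j)
        + periodic_ext u (int j - 1)) / h\<^sup>2)
      + (periodic_ext w (int j + 1) - periodic_ext w (int j)) / h
        * ((periodic_ext u (int j + 1) - periodic_ext u (int j)) / h))"
    using u w
    by (simp add: scalar_prod_def dx_sq_def dx_plus_def lessThan_atLeast0 periodic_ext_int sum.distrib)
  also have "\<dots> = (\<Sum>j<N. g (Suc j) - g j)"
    unfolding * g_def by (simp add: add.commute)
  also have "\<dots> = g N - g 0" by (rule sum_lessThan_telescope)
  \<comment> \<open>The backward difference in \<open>g 0\<close> reaches index -1, hence the third
    use of periodicity.\<close>
  also have "\<dots> = 0"
    using periodic_ext_add_period[of w 0] periodic_ext_add_period[of u 0]
      periodic_ext_add_period[of u "-1"] u w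
    by (simp add: g_def algebra_simps)
  finally show ?thesis by simp
qed

text \<open>Summation by parts on unit vectors exhibits the matrix as minus a Gram matrix of forward
  differences, so no case distinction at the periodic wrap-around arises.\<close>

lemma B2_mat_sym:
  assumes ij: "i < N" "j < N"
  shows "B2_mat N h $$ (i, j) = B2_mat N h $$ (j, i)"
proof -
  have "B2_mat N h $$ (i, j) = - (dx_plus h (unit_vec N i) \<bullet> dx_plus h (unit_vec N j))"
    if "i < N" "j < N" for i j
    using that dx_sq_summation_by_parts[of "unit_vec N j" N "unit_vec N i" h]
      scalar_prod_left_unit[of "dx_sq h (unit_vec N j)" N i]
    by (simp add: B2_mat_def carrier_dim_vec)
  then show ?thesis
    using ij comm_scalar_prod[of "dx_plus h (unit_vec N i)" N "dx_plus h (unit_vec N j)"]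
    by (simp add: carrier_dim_vec)
qed

section \<open>The discrete energy as a quadratic form of the block matrix M\<close>

lemma l2_norm_sq: "0 \<le> h \<Longrightarrow> (l2_norm h v)\<^sup>2 = h * (v \<bullet> v)"
  by (simp add: l2_norm_def sum_nonneg scalar_prod_def lessThan_atLeast0 power2_eq_square)

lemma B2_mat_carrier: "B2_mat N h \<in> carrier_mat N N"
  by (simp add: B2_mat_def)

lemma smult_mat_mult_vec:
  fixes A :: "'a :: comm_semiring_0 mat"
  assumes "A \<in> carrier_mat m n" "x \<in> carrier_vec n"
  shows "(c \<cdot>\<^sub>m A) *\<^sub>v x = c \<cdot>\<^sub>v (A *\<^sub>v x)"
  using assms by (intro eq_vecI) (simp_all add: scalar_prod_def sum_distrib_left mult.assoc)

lemma M_mat_quadratic_form: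
  assumes u: "u \<in> carrier_vec N" and v: "v \<in> carrier_vec N"
  shows "(u @\<^sub>v v) \<bullet> (M_mat N h \<omega> *\<^sub>v (u @\<^sub>v v)) = \<omega>\<^sup>2 * (dx_plus h u \<bullet> dx_plus h u) + v \<bullet> v"
proof -
  have B: "- (\<omega>\<^sup>2) \<cdot>\<^sub>m B2_mat N h \<in> carrier_mat N N"
    by (rule smult_carrier_mat[OF B2_mat_carrier])
  have "M_mat N h \<omega> *\<^sub>v (u @\<^sub>v v) = ((- (\<omega>\<^sup>2) \<cdot>\<^sub>m B2_mat N h) *\<^sub>v u) @\<^sub>v v"
    unfolding M_mat_def mult_mat_vec_split[OF B one_carrier_mat u v] one_mult_mat_vec[OF v] ..
  also have "(- (\<omega>\<^sup>2) \<cdot>\<^sub>m B2_mat N h) *\<^sub>v u = - (\<omega>\<^sup>2) \<cdot>\<^sub>v dx_sq h u"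
    unfolding smult_mat_mult_vec[OF B2_mat_carrier u] B2_mat_mult_vec[OF u] ..
  finally have *: "M_mat N h \<omega> *\<^sub>v (u @\<^sub>v v) = (- (\<omega>\<^sup>2) \<cdot>\<^sub>v dx_sq h u) @\<^sub>v v" .
  have D: "dx_sq h u \<in> carrier_vec N"
    using u by (intro carrier_vecI) (simp only: dim_dx carrier_vecD)
  then have "- (\<omega>\<^sup>2) \<cdot>\<^sub>v dx_sq h u \<in> carrier_vec N"
    by (simp only: smult_carrier_vec)
  from scalar_prod_append[OF u v this v]
  have "(u @\<^sub>v v) \<bullet> (M_mat N h \<omega> *\<^sub>v (u @\<^sub>v v)) = u \<bullet> (- (\<omega>\<^sup>2) \<cdot>\<^sub>v dx_sq h u) + v \<bullet> v"
    unfolding * .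
  also have "u \<bullet> (- (\<omega>\<^sup>2) \<cdot>\<^sub>v dx_sq h u) = - (\<omega>\<^sup>2) * (u \<bullet> dx_sq h u)"
    using scalar_prod_smult_distrib[OF u D] .
  finally show ?thesis
    unfolding dx_sq_summation_by_parts[OF u u] minus_mult_minus .
qed

text \<open>Brings the energy into the shape of the Hamiltonian conserved by the exponential step,
  with weight \<open>h\<close>.\<close>

lemma modified_energy_eq:
  assumes "u \<in> carrier_vec N" "v \<in> carrier_vec N" "0 \<le> h"
  shows "modified_energy h \<omega> C0 u v q
    = h * (1/2 * ((u @\<^sub>v v) \<bullet> (M_mat N h \<omega> *\<^sub>v (u @\<^sub>v v)))) + q\<^sup>2 - C0"
  unfolding modified_energy_def M_mat_quadratic_form[OF assms(1,2)] l2_norm_sq[OF assms(3)]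
  by (simp add: algebra_simps)

section \<open>Balance of the quadratic energy against the auxiliary variable\<close>

theorem theorem4p1:
  fixes a b h \<tau> \<omega> C0 :: real
    and N :: nat
    and G \<phi>1 \<phi>2 :: "real \<Rightarrow> real"
    and u v :: "nat \<Rightarrow> real Matrix.vec"
    and q :: "nat \<Rightarrow> real"
  assumes interval: "a < b"
    and N_even: "even N" and N_pos: "0 < N"
    and h_eq: "h = (b - a) / real N"
    and tau_pos: "0 < \<tau>"
    and G_smooth: "smooth G" and G_nonneg: "\<And>x. 0 \<le> G x"
    and u_dim: "\<And>n. u n \<in> carrier_vec N" and v_dim: "\<And>n. v n \<in> carrier_vec N"
    and C0_init: "0 < G_energy h C0 G (u 0)"
    and C0_pos: "\<And>n. 0 < G_energy h C0 G (u_hat u n)"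
    and u_init: "\<And>j. j < N \<Longrightarrow> u 0 $ j = \<phi>1 (a + real j * h)"
    and v_init: "\<And>j. j < N \<Longrightarrow> v 0 $ j = \<phi>2 (a + real j * h)"
    and q_init: "q 0 = sqrt (G_energy h C0 G (u 0))"
    and z_step: "\<And>n. u (Suc n) @\<^sub>v v (Suc n) =
        mat_exp (V_mat N h \<omega> \<tau>) *\<^sub>v (u n @\<^sub>v v n)
        + \<tau> \<cdot>\<^sub>v ((mat_phi (V_mat N h \<omega> \<tau>) * S_mat N)
               *\<^sub>v f_half h C0 G (u_hat u n) (1/2 * (q (Suc n) + q n)))"
    and q_step: "\<And>n. q (Suc n) = q n
        + \<tau> * (l2_inner h (map_vec (deriv G) (u_hat u n)) ((1 / \<tau>) \<cdot>\<^sub>v (u (Suc n) - u n))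
               / (2 * sqrt (G_energy h C0 G (u_hat u n))))"
  shows "\<forall>n. modified_energy h \<omega> C0 (u (Suc n)) (v (Suc n)) (q (Suc n))
           = modified_energy h \<omega> C0 (u n) (v n) (q n)"
proof
  fix n
  have h: "0 \<le> h" using interval by (simp add: h_eq)
  \<comment> \<open>The same \<open>uh\<close> enters the updates of both z and \<open>q\<close>, so
    the first step and the extrapolated later ones are treated at once.\<close>
  define uh where "uh = u_hat u n"
  define r where "r = sqrt (G_energy h C0 G uh)"
  define p where "p = map_vec (deriv G) uh"
  define c where "c = 1 / r * (1/2 * (q (Suc n) + q n))"
  define f where "f = f_half h C0 G uh (1/2 * (q (Suc n) + q n))"
  have uh: "uh \<in> carrier_vec N" using u_dim by (simp add: uh_def u_hat_def)
  have p: "p \<in> carrier_vec N" using uh by (simp add: p_def)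
  have f_eq: "f = (c \<cdot>\<^sub>v p) @\<^sub>v 0\<^sub>v N"
    using uh by (simp add: f_def f_half_def c_def r_def p_def)
  have f: "f \<in> carrier_vec (N + N)" unfolding f_eq using p by simp
  \<comment> \<open>The lower block of \<open>f\<close> vanishes, so the force term sees only the
    displacement.\<close>
  have fz: "f \<bullet> (x @\<^sub>v y) = c * (p \<bullet> x)" if "x \<in> carrier_vec N" "y \<in> carrier_vec N" for x y
    unfolding f_eq using p that by (simp add: scalar_prod_append[of _ N _ N])
  have M: "M_mat N h \<omega> \<in> carrier_mat (N + N) (N + N)" by (simp add: M_mat_def B2_mat_def)
  have S: "S_mat N \<in> carrier_mat (N + N) (N + N)" by (simp add: S_mat_def)
  let ?Q = "\<lambda>n. 1/2 * ((u n @\<^sub>v v n) \<bullet> (M_mat N h \<omega> *\<^sub>v (u n @\<^sub>v v n)))"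
  have "?Q (Suc n) + f \<bullet> (u (Suc n) @\<^sub>v v (Suc n)) = ?Q n + f \<bullet> (u n @\<^sub>v v n)"
  proof (rule exponential_integrator_energy[OF M S f])
    show "u n @\<^sub>v v n \<in> carrier_vec (N + N)" using u_dim v_dim by simp
    show "M_mat N h \<omega> $$ (i, j) = M_mat N h \<omega> $$ (j, i)" if "i < N + N" "j < N + N" for i j
    proof -
      have "dim_row (B2_mat N h) = N" "dim_col (B2_mat N h) = N" by (simp_all add: B2_mat_def)
      then show ?thesis using that B2_mat_sym[of i N j h] by (auto simp: M_mat_def)
    qed
    show "S_mat N $$ (i, j) = - S_mat N $$ (j, i)" if "i < N + N" "j < N + N" for i j
      using that by (auto simp: S_mat_def)
    show "u (Suc n) @\<^sub>v v (Suc n) = mat_exp (\<tau> \<cdot>\<^sub>m (S_mat N * M_mat N h \<omega>)) *\<^sub>v (u n @\<^sub>v v n)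
        + \<tau> \<cdot>\<^sub>v ((mat_phi (\<tau> \<cdot>\<^sub>m (S_mat N * M_mat N h \<omega>)) * S_mat N) *\<^sub>v f)"
      using z_step[of n] by (simp only: V_mat_def f_def uh_def)
  qed
  then have Q: "?Q (Suc n) - ?Q n = c * (p \<bullet> u n) - c * (p \<bullet> u (Suc n))"
    using u_dim v_dim by (simp add: fz)
  have "l2_inner h p ((1 / \<tau>) \<cdot>\<^sub>v (u (Suc n) - u n)) = h * (p \<bullet> ((1 / \<tau>) \<cdot>\<^sub>v (u (Suc n) - u n)))"
    using p carrier_vecD[OF u_dim] by (simp add: l2_inner_def scalar_prod_def lessThan_atLeast0)
  also have "\<dots> = h / \<tau> * (p \<bullet> u (Suc n) - p \<bullet> u n)"
    using p u_dim[of n] u_dim[of "Suc n"] by (simp add: scalar_prod_minus_distrib[OF p])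
  finally have dq: "q (Suc n) - q n = h * (p \<bullet> u (Suc n) - p \<bullet> u n) / (2 * r)"
    using q_step[of n] tau_pos by (simp add: uh_def r_def p_def)
  \<comment> \<open>The sum of the two values of \<open>q\<close> divided by \<open>2 * r\<close> is
    exactly \<open>c\<close>: the midpoint value in the force matches the factor 2 in the update of
    \<open>q\<close>, so the two energy changes cancel.\<close>
  have "(q (Suc n))\<^sup>2 - (q n)\<^sup>2 = (q (Suc n) - q n) * (q (Suc n) + q n)"
    by (simp add: power2_eq_square algebra_simps)
  also have "\<dots> = h * (c * (p \<bullet> u (Suc n)) - c * (p \<bullet> u n))"
    unfolding dq c_def by (simp add: algebra_simps add_divide_distrib diff_divide_distrib)
  also have "\<dots> = - (h * (?Q (Suc n) - ?Q n))"
    unfolding Q by (simp add: algebra_simps)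
  finally have "h * ?Q (Suc n) + (q (Suc n))\<^sup>2 = h * ?Q n + (q n)\<^sup>2"
    by (simp only: right_diff_distrib)
  then show "modified_energy h \<omega> C0 (u (Suc n)) (v (Suc n)) (q (Suc n))
      = modified_energy h \<omega> C0 (u n) (v n) (q n)"
    using modified_energy_eq[OF u_dim v_dim h] by simp
qed

end
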